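(* For every $V\in\mathcal V^*$, let $u_0:[-T,T]\to\mathbb R^2$ be the transmission solution extending a collision solution of $\ddot u=\nabla V(|u|)$ (with the collision at time $t=0$). Then $u_0$ is not a minimal path for the action functional $$\mathcal A(u)=\int_{-T}^{T}\Big(\tfrac12|\dot u(t)|^2+V(|u(t)|)\Big)\,dt$$ restricted to $$\Lambda=\{u:\ \dot u\in L^2([-T,T]),\ u(-T)=u_0(-T),\ u(T)=u_0(T)\},$$ the set of paths in $\mathbb{R}^2$ joining the end points of $u_0$.
   Context: **The classes $\mathcal V$ and $\mathcal V^*$.** $\mathcal V$ is the set of functions $V\in C^\infty(\mathbb R^+,\mathbb R)$, $\mathbb R^+=(0,\infty)$, such that (i) $\lim_{x\to0^+}V(x)=+\infty$; there exists $S\in(0,+\infty]$ such that on $(0,S)$: (ii) $V'(x)<0$ and $V''(x)>0$; (iii) $V'(x)/V''(x)$ is decreasing in $x$; and (iv) $\frac{d}{dx}\frac{V'(x)}{V''(x)}\big|_{x=0}<-\frac12$ (right derivative at $0$ of the function $V'/V''$ extended by continuity to $x=0$). $\mathcal V^*$ is the set of $V\in\mathcal V$ such that (v) $\lim_{\lambda\to0^+}V(\lambda x)/V(\lambda)=1$ for every $x\ge1$, uniformly on every compact $[1,M]$. **Transmission solution.** A collision solution is a classical solution of $\ddot u=\nabla V(|u|)$ (gradient with respect to $u\in\mathbb R^2$) whose position tends to $0$ at a finite time. For a collision solution $\bar u:[-T,0)\to\mathbb R^2\setminus\{0\}$ colliding at time $0$, the transmission solution $u_0:[-T,T]\to\mathbb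 R^2$ is $u_0(t)=\bar u(t)$ for $t\in[-T,0)$, $u_0(0)=0$, $u_0(t)=-\bar u(-t)$ for $t\in(0,T]$. *)

theory Defs
  imports "HOL-Analysis.Analysis"
begin

(* Potentials are total functions real => real; only their values on (0,\<infinity>) matter. *)
definition smooth_on_pos :: "(real \<Rightarrow> real) \<Rightarrow> bool" where
  "smooth_on_pos V \<longleftrightarrow> (\<forall>n. \<forall>x>0. ((deriv ^^ n) V) field_differentiable (at x))"

definition deriv_ratio :: "(real \<Rightarrow> real) \<Rightarrow> real \<Rightarrow> real" where
  "deriv_ratio V x = deriv V x / deriv (deriv V) x"

(* "Decreasing" is read in the weak sense, which gives the larger class.
   L is the value at 0 of the continuous extension of V'/V'', and d its right derivative there. *)
definition class_V :: "(real \<Rightarrow> real) set" where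
  "class_V = {V. smooth_on_pos V \<and>
     filterlim V at_top (at_right 0) \<and>
     (\<exists>S::ereal. 0 < S \<and>
        (\<forall>x. 0 < x \<and> ereal x < S \<longrightarrow> deriv V x < 0 \<and> deriv (deriv V) x > 0) \<and>
        antimono_on {x. 0 < x \<and> ereal x < S} (deriv_ratio V) \<and>
        (\<exists>L d. (deriv_ratio V \<longlongrightarrow> L) (at_right 0) \<and>
           ((\<lambda>x. if x = 0 then L else deriv_ratio V x) has_real_derivative d)
              (at 0 within {0..}) \<and>
           d < - 1 / 2))}"

definition class_V_star :: "(real \<Rightarrow> real) set" where
  "class_V_star = {V \<in> class_V.
     \<forall>M\<ge>1. uniform_limit {1..M} (\<lambda>l x. V (l * x) / V l) (\<lambda>x. 1) (at_right 0)}"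

(* At the endpoint -T the derivatives are one-sided. *)
definition collision_solution :: "(real \<Rightarrow> real) \<Rightarrow> real \<Rightarrow> (real \<Rightarrow> real^2) \<Rightarrow> bool" where
  "collision_solution V T u \<longleftrightarrow>
     (\<forall>t\<in>{-T..<0}. u t \<noteq> 0) \<and>
     (\<exists>v a. \<forall>t\<in>{-T..<0}.
        (u has_vector_derivative v t) (at t within {-T..<0}) \<and>
        (v has_vector_derivative a t) (at t within {-T..<0}) \<and>
        (GDERIV (\<lambda>y. V (norm y)) (u t) :> a t)) \<and>
     (u \<longlongrightarrow> 0) (at_left 0)"

definition transmission :: "(real \<Rightarrow> real^2) \<Rightarrow> real \<Rightarrow> real^2" where
  "transmission u t = (if t < 0 then u t else if t = 0 then 0 else - u (- t))"

definition velocity :: "(real \<Rightarrow> real^2) \<Rightarrow> real \<Rightarrow> real^2" where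
  "velocity u t = vector_derivative u (at t)"

(* The Sobolev space H^1 on [-T,T]: absolutely continuous paths, i.e. those recovered by
   integration from their almost everywhere defined derivative, with derivative in L^2. *)
definition H1_path :: "real \<Rightarrow> (real \<Rightarrow> real^2) \<Rightarrow> bool" where
  "H1_path T u \<longleftrightarrow>
     set_borel_measurable lebesgue {-T..T} (velocity u) \<and>
     set_integrable lebesgue {-T..T} (\<lambda>t. (norm (velocity u t))\<^sup>2) \<and>
     (\<forall>t\<in>{-T..T}. u t = u (-T) + (LINT s:{-T..t}|lebesgue. velocity u s))"

definition joining_paths :: "real \<Rightarrow> real^2 \<Rightarrow> real^2 \<Rightarrow> (real \<Rightarrow> real^2) set" where
  "joining_paths T p q = {u. H1_path T u \<and> u (-T) = p \<and> u T = q}"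

(* V(0) is taken to be the limit value \<infinity>. *)
definition lagrangian :: "(real \<Rightarrow> real) \<Rightarrow> (real \<Rightarrow> real^2) \<Rightarrow> real \<Rightarrow> ereal" where
  "lagrangian V u t =
     ereal ((norm (velocity u t))\<^sup>2 / 2) + (if u t = 0 then \<infinity> else ereal (V (norm (u t))))"

(* Integral of the positive part minus integral of the negative part. For an H^1 path the latter
   is finite when V is continuous on (0,\<infinity>) and tends to \<infinity> at 0, as V(|u|) is then bounded
   below; so the action takes values in (-\<infinity>,\<infinity>]. *)
definition action :: "(real \<Rightarrow> real) \<Rightarrow> real \<Rightarrow> (real \<Rightarrow> real^2) \<Rightarrow> ereal" where
  "action V T u =
     enn2ereal (\<integral>\<^sup>+t\<in>{-T..T}. e2ennreal (lagrangian V u t) \<partial>lebesgue) -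
     enn2ereal (\<integral>\<^sup>+t\<in>{-T..T}. e2ennreal (- lagrangian V u t) \<partial>lebesgue)"

end

theory Submission
  imports Defs
begin

text \<open>
  Slow variation makes \<open>x V(x)\<close> bounded near \<open>0\<close>. By conservation of energy the angular momentum of
  a collision solution then vanishes, so the motion is radial, \<open>u = r e\<close>, and \<open>\<integral> r'\<^sup>2\<close> is finite up
  to the collision; thus the transmission solution has finite action. Push it off the origin by a
  tent of height \<open>\<delta> = \<rho> / 2\<close> and fixed width \<open>2 \<tau>\<close> in the direction normal to \<open>e\<close>. This costs
  kinetic action \<open>\<delta>\<^sup>2 / \<tau>\<close>, of order \<open>\<rho>\<^sup>2\<close>. As \<open>V\<close> decreases and is convex near \<open>0\<close>, the potential
  part decreases by at least a constant times \<open>\<bar>V'(\<rho>)\<bar> \<rho>\<close> during the time the radius needs to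
  descend from \<open>\<rho> / 2\<close> to \<open>\<rho> / 4\<close>, which by energy conservation and slow variation is at least a
  constant times \<open>\<rho> / \<surd>V(\<rho>)\<close>. Since \<open>V\<close>, and hence \<open>\<surd>V\<close>, is unbounded at \<open>0\<close>, the quotient
  \<open>\<bar>V'(\<rho>)\<bar> / \<surd>V(\<rho>)\<close> is unbounded, and for a suitable \<open>\<rho>\<close> the gain exceeds the cost.
\<close>

section \<open>Paths and their action\<close>

text \<open>The fundamental theorem of calculus tolerates finitely many exceptional points and
  recovers \<open>w\<close> as a gauge integral. The bound \<open>x \<le> 1 + x\<^sup>2\<close>
  makes the velocity absolutely integrable, so this gauge integral is the Lebesgue integral that
  \<open>H1_path\<close> asks for.\<close>

lemma H1_pathI:
  fixes w w' :: "real \<Rightarrow> real^2"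
  assumes "finite N" and cont: "continuous_on {-T..T} w"
    and deriv: "\<And>t. t \<in> {-T<..<T} - N \<Longrightarrow> (w has_vector_derivative w' t) (at t)"
    and sq: "(\<lambda>t. (norm (w' t))\<^sup>2) integrable_on {-T..T}"
    and "T > 0"
  shows "H1_path T w"
proof -
  have vel: "velocity w t = w' t" if "t \<in> {-T<..<T} - N" for t
    unfolding velocity_def using deriv[OF that] by (rule vector_derivative_at)
  have ftc: "(velocity w has_integral (w t - w (-T))) {-T..t}" if "t \<in> {-T..T}" for t
  proof (rule fundamental_theorem_of_calculus_interior_strong[OF \<open>finite N\<close>])
    show "continuous_on {-T..t} w"
      by (rule continuous_on_subset[OF cont]) (use that in auto)
    show "(w has_vector_derivative velocity w x) (at x)" if "x \<in> {-T<..<t} - N" for x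
      using deriv[of x] vel[of x] that \<open>t \<in> {-T..T}\<close> by auto
  qed (use that in auto)
  have meas: "set_borel_measurable lebesgue {-T..T} (velocity w)"
    unfolding set_borel_measurable_def
    using has_integral_implies_lebesgue_measurable[OF ftc[of T]] \<open>T > 0\<close> by simp
  have sq': "(\<lambda>t. (norm (velocity w t))\<^sup>2) integrable_on {-T..T}"
    by (rule integrable_spike_finite[OF _ _ sq, of "N \<union> {-T, T}"])
      (use vel \<open>finite N\<close> in auto)
  have "velocity w absolutely_integrable_on {-T..T}"
  proof (rule measurable_bounded_by_integrable_imp_absolutely_integrable)
    show "velocity w \<in> borel_measurable (lebesgue_on {-T..T})"
      using meas by (simp add: set_borel_measurable_def borel_measurable_restrict_space_iff)
    show "(\<lambda>t. 1 + (norm (velocity w t))\<^sup>2) integrable_on {-T..T}"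
      by (intro integrable_add sq') auto
    show "norm (velocity w t) \<le> 1 + (norm (velocity w t))\<^sup>2" for t
      using zero_le_power2[of "norm (velocity w t) - 1"] norm_ge_zero[of "velocity w t"]
      unfolding power2_diff by (simp; linarith)
  qed auto
  then have ac: "(LINT s:{-T..t}|lebesgue. velocity w s) = w t - w (-T)" if "t \<in> {-T..T}" for t
  proof -
    have "velocity w absolutely_integrable_on {-T..t}"
      by (rule set_integrable_subset[OF \<open>velocity w absolutely_integrable_on {-T..T}\<close>])
        (use that in auto)
    then show ?thesis
      using set_lebesgue_integral_eq_integral(2) integral_unique[OF ftc[OF that]] by metis
  qed
  show ?thesis
    unfolding H1_path_def
    using meas nonnegative_absolutely_integrable_1[OF sq'] ac by simp
qed

text \<open>A finite set is null, so the Lagrangian may be infinite there, as it is at a collision.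
  Absolute integrability of \<open>f\<close> makes both integrals in \<open>action\<close> finite,
  and their difference in \<open>ereal\<close> is then the real one.\<close>

lemma action_eq_integral:
  assumes f: "f absolutely_integrable_on {-T..T}"
    and "finite N"
    and lag: "\<And>t. t \<in> {-T..T} - N \<Longrightarrow> lagrangian V w t = ereal (f t)"
  shows "action V T w = ereal (integral {-T..T} f)"
proof -
  define F where "F t = indicator {-T..T} t * f t" for t
  have F: "integrable lebesgue F"
    using f by (simp add: set_integrable_def F_def[abs_def])
  have ae: "AE t in lebesgue. t \<notin> N"
    using \<open>finite N\<close> by (intro AE_not_in negligible_iff_null_sets[THEN iffD1]) (auto simp: negligible_finite)
  have pos: "(\<integral>\<^sup>+t\<in>{-T..T}. e2ennreal (lagrangian V w t) \<partial>lebesgue) = (\<integral>\<^sup>+t. ennreal (F t) \<partial>lebesgue)"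
    by (rule nn_integral_cong_AE, use ae in eventually_elim)
      (auto simp: F_def lag ennreal.rep_eq e2ennreal_ereal indicator_def)
  have neg: "(\<integral>\<^sup>+t\<in>{-T..T}. e2ennreal (- lagrangian V w t) \<partial>lebesgue) = (\<integral>\<^sup>+t. ennreal (- F t) \<partial>lebesgue)"
    by (rule nn_integral_cong_AE, use ae in eventually_elim)
      (auto simp: F_def lag e2ennreal_ereal indicator_def)
  have fin: "(\<integral>\<^sup>+t. ennreal (F t) \<partial>lebesgue) \<noteq> \<infinity>" "(\<integral>\<^sup>+t. ennreal (- F t) \<partial>lebesgue) \<noteq> \<infinity>"
    using F by (auto simp: real_integrable_def)
  have "integral {-T..T} f = integral\<^sup>L lebesgue F"
    using set_lebesgue_integral_eq_integral(2)[OF f]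
    by (simp add: set_lebesgue_integral_def F_def[abs_def])
  also have "ereal \<dots> = enn2ereal (\<integral>\<^sup>+t. ennreal (F t) \<partial>lebesgue) - enn2ereal (\<integral>\<^sup>+t. ennreal (- F t) \<partial>lebesgue)"
    unfolding real_lebesgue_integral_def[OF F]
    using fin by (cases "\<integral>\<^sup>+t. ennreal (F t) \<partial>lebesgue"; cases "\<integral>\<^sup>+t. ennreal (- F t) \<partial>lebesgue")
      (auto simp: enn2ereal_ennreal)
  finally show ?thesis
    unfolding action_def pos neg by simp
qed

section \<open>The tent function and its kinetic cost\<close>

definition bump :: "real \<Rightarrow> real \<Rightarrow> real \<Rightarrow> real" where
  "bump \<tau> \<delta> t = \<delta> * max 0 (1 - \<bar>t\<bar> / \<tau>)"

text \<open>The values at the kinks are a convention; the one at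
  \<open>\<bar>t\<bar> = \<tau>\<close> makes the square constant on the closed interval
  \<open>{-\<tau>..\<tau>}\<close> apart from \<open>0\<close>.\<close>

definition bump_deriv :: "real \<Rightarrow> real \<Rightarrow> real \<Rightarrow> real" where
  "bump_deriv \<tau> \<delta> t = (if \<bar>t\<bar> \<le> \<tau> then - \<delta> * sgn t / \<tau> else 0)"

lemma bump_has_derivative:
  assumes "\<tau> > 0" "t \<notin> {-\<tau>, 0, \<tau>}"
  shows "(bump \<tau> \<delta> has_real_derivative bump_deriv \<tau> \<delta> t) (at t)"
proof -
  consider "t < -\<tau>" | "-\<tau> < t" "t < 0" | "0 < t" "t < \<tau>" | "\<tau> < t"
    using assms by fastforce
  then show ?thesis
  proof cases
    case 1
    show ?thesis
      by (rule has_field_derivative_transform_within_open[of "\<lambda>_. 0" _ _ "{..<-\<tau>}"])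
        (use 1 assms in \<open>auto simp: bump_def bump_deriv_def field_simps\<close>)
  next
    case 2
    show ?thesis
      by (rule has_field_derivative_transform_within_open[of "\<lambda>s. \<delta> * (1 + s / \<tau>)" _ _ "{-\<tau><..<0}"])
        (use 2 assms in \<open>auto intro!: derivative_eq_intros simp: bump_def bump_deriv_def field_simps\<close>)
  next
    case 3
    show ?thesis
      by (rule has_field_derivative_transform_within_open[of "\<lambda>s. \<delta> * (1 - s / \<tau>)" _ _ "{0<..<\<tau>}"])
        (use 3 assms in \<open>auto intro!: derivative_eq_intros simp: bump_def bump_deriv_def field_simps\<close>)
  next
    case 4
    show ?thesis
      by (rule has_field_derivative_transform_within_open[of "\<lambda>_. 0" _ _ "{\<tau><..}"])
        (use 4 assms in \<open>auto simp: bump_def bump_deriv_def field_simps\<close>)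
  qed
qed

lemma bump_deriv_squared:
  "t \<noteq> 0 \<Longrightarrow> (bump_deriv \<tau> \<delta> t)\<^sup>2 = (if t \<in> {-\<tau>..\<tau>} then \<delta>\<^sup>2 / \<tau>\<^sup>2 else 0)"
  by (auto simp: bump_deriv_def power_divide power_mult_distrib sgn_if)

text \<open>Half of this value, \<open>\<delta>\<^sup>2 / \<tau>\<close>, is the kinetic action that
  the tent adds.\<close>

lemma bump_deriv_squared_has_integral:
  assumes "0 < \<tau>" "\<tau> < T"
  shows "((\<lambda>t. (bump_deriv \<tau> \<delta> t)\<^sup>2) has_integral 2 * \<delta>\<^sup>2 / \<tau>) {-T..T}"
proof -
  have "((\<lambda>_. \<delta>\<^sup>2 / \<tau>\<^sup>2) has_integral (\<tau> - (-\<tau>)) *\<^sub>R (\<delta>\<^sup>2 / \<tau>\<^sup>2)) {-\<tau>..\<tau>}"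
    using has_integral_const_real[of "\<delta>\<^sup>2 / \<tau>\<^sup>2" "-\<tau>" \<tau>] assms by simp
  moreover have "(\<tau> - (-\<tau>)) *\<^sub>R (\<delta>\<^sup>2 / \<tau>\<^sup>2) = 2 * \<delta>\<^sup>2 / \<tau>"
    using assms by (simp add: field_simps power2_eq_square)
  ultimately have "((\<lambda>t. if t \<in> {-\<tau>..\<tau>} then \<delta>\<^sup>2 / \<tau>\<^sup>2 else 0) has_integral 2 * \<delta>\<^sup>2 / \<tau>) {-T..T}"
    using assms by (subst has_integral_restrict) auto
  then show ?thesis
    by (rule has_integral_spike_finite[rotated 2, of _ _ _ "{0}"]) (use bump_deriv_squared in auto)
qed

section \<open>Planar geometry and angular momentum\<close>

lemma norm_orthonormal_combination:
  fixes e n :: "'a::real_inner"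
  assumes "norm e = 1" "norm n = 1" "e \<bullet> n = 0"
  shows "norm (x *\<^sub>R e + y *\<^sub>R n) = sqrt (x\<^sup>2 + y\<^sup>2)"
proof -
  have "e \<bullet> e = 1" "n \<bullet> n = 1" "n \<bullet> e = 0"
    using assms by (simp_all add: norm_eq_1 inner_commute)
  then show ?thesis
    using assms by (simp add: norm_eq_sqrt_inner inner_add_left inner_add_right power2_eq_square)
qed

text \<open>The force \<open>k t *\<^sub>R u t\<close> is central, so all terms of the derivative
  cancel.\<close>

lemma angular_momentum_conserved:
  fixes u v :: "real \<Rightarrow> real^2"
  assumes "convex I"
    and u: "\<And>t. t \<in> I \<Longrightarrow> (u has_vector_derivative v t) (at t within I)"
    and v: "\<And>t. t \<in> I \<Longrightarrow> (v has_vector_derivative k t *\<^sub>R u t) (at t within I)"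
  obtains c where "\<And>t. t \<in> I \<Longrightarrow> u t $ 1 * v t $ 2 - u t $ 2 * v t $ 1 = c"
proof -
  have "((\<lambda>t. u t $ 1 * v t $ 2 - u t $ 2 * v t $ 1) has_real_derivative 0) (at t within I)"
    if t: "t \<in> I" for t
  proof -
    have "((\<lambda>t. u t $ i) has_real_derivative v t $ i) (at t within I)"
      "((\<lambda>t. v t $ i) has_real_derivative k t * u t $ i) (at t within I)" for i
      using bounded_linear.has_vector_derivative[OF bounded_linear_vec_nth u[OF t], of i]
        bounded_linear.has_vector_derivative[OF bounded_linear_vec_nth v[OF t], of i]
      by (simp_all add: has_real_derivative_iff_has_vector_derivative)
    then show ?thesis by (auto intro!: derivative_eq_intros)
  qed
  then show ?thesis
    using has_field_derivative_zero_constant[OF \<open>convex I\<close>] that by blast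
qed

text \<open>Serves to turn vanishing angular momentum into motion along a line; the form without
  division also holds for \<open>x = 0\<close>.\<close>

lemma cross_zero_imp_parallel:
  fixes x y :: "real^2"
  assumes "x $ 1 * y $ 2 - x $ 2 * y $ 1 = 0"
  shows "(x \<bullet> x) *\<^sub>R y = (x \<bullet> y) *\<^sub>R x"
proof -
  have "(x $ 1 * x $ 1 + x $ 2 * x $ 2) * y $ 1 = (x $ 1 * y $ 1 + x $ 2 * y $ 2) * x $ 1"
    "(x $ 1 * x $ 1 + x $ 2 * x $ 2) * y $ 2 = (x $ 1 * y $ 1 + x $ 2 * y $ 2) * x $ 2"
    using assms by algebra+
  then show ?thesis by (simp add: vec_eq_iff forall_2 inner_vec_def sum_2)
qed

text \<open>Lagrange's identity in the plane: the defect is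
  \<open>(x \<bullet> y)\<^sup>2\<close>.\<close>

lemma cross_squared_le:
  fixes x y :: "real^2"
  shows "(x $ 1 * y $ 2 - x $ 2 * y $ 1)\<^sup>2 \<le> (x \<bullet> x) * (y \<bullet> y)"
proof -
  have "(x \<bullet> x) * (y \<bullet> y) = (x $ 1 * y $ 2 - x $ 2 * y $ 1)\<^sup>2 + (x \<bullet> y)\<^sup>2"
    by (simp add: inner_vec_def sum_2 power2_eq_square algebra_simps)
  then show ?thesis by simp
qed

section \<open>Potentials near the collision\<close>

text \<open>Differentiability is kept on all of the positive axis, since a collision solution may
  start far from the origin; signs and slow variation are recorded only up to \<open>R\<close>. The
  factor 2 in \<open>V_quadruple\<close> does not exceed the scaling 4, which is what bounds
  \<open>x * V x\<close>.\<close>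

locale collapsing_potential =
  fixes V :: "real \<Rightarrow> real" and R :: real
  assumes R_pos: "R > 0"
    and V_deriv: "\<And>x. x > 0 \<Longrightarrow> (V has_real_derivative deriv V x) (at x)"
    and V_deriv2: "\<And>x. x > 0 \<Longrightarrow> (deriv V has_real_derivative deriv (deriv V) x) (at x)"
    and V_blowup: "filterlim V at_top (at_right 0)"
    and V_pos: "\<And>x. 0 < x \<Longrightarrow> x \<le> R \<Longrightarrow> V x > 0"
    and V_decreasing: "\<And>x. 0 < x \<Longrightarrow> x \<le> R \<Longrightarrow> deriv V x < 0"
    and V_convex: "\<And>x. 0 < x \<Longrightarrow> x \<le> R \<Longrightarrow> deriv (deriv V) x > 0"
    and V_quadruple: "\<And>x. 0 < x \<Longrightarrow> 4 * x \<le> R \<Longrightarrow> V x \<le> 2 * V (4 * x)"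

text \<open>Slow variation on \<open>{1..4}\<close> with tolerance 1/2 gives
  \<open>V (4 * l) / V l > 1/2\<close> for small \<open>l\<close>, which is
  \<open>V_quadruple\<close>.\<close>

lemma class_V_star_collapsing:
  assumes "V \<in> class_V_star"
  obtains R where "collapsing_potential V R"
proof -
  from assms obtain S :: ereal where smooth: "smooth_on_pos V"
    and blowup: "filterlim V at_top (at_right 0)" and "0 < S"
    and S: "\<And>x. 0 < x \<Longrightarrow> ereal x < S \<Longrightarrow> deriv V x < 0 \<and> deriv (deriv V) x > 0"
    and unif: "\<And>M. M \<ge> 1 \<Longrightarrow> uniform_limit {1..M} (\<lambda>l x. V (l * x) / V l) (\<lambda>x. 1) (at_right 0)"
    unfolding class_V_star_def class_V_def by blast
  from \<open>0 < S\<close> obtain s :: real where s: "0 < s" "ereal s < S"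
    by (metis ereal_dense2 ereal_less(2))
  have "\<forall>\<^sub>F l in at_right 0. \<forall>x\<in>{1..4}. dist (V (l * x) / V l) 1 < 1/2"
    using uniform_limitD[OF unif[of 4], of "1/2"] by simp
  moreover have "\<forall>\<^sub>F l in at_right 0. V l > 0"
    using blowup by (simp add: filterlim_at_top_dense)
  ultimately have "\<forall>\<^sub>F l in at_right 0. V l > 0 \<and> V l \<le> 2 * V (4 * l)"
  proof eventually_elim
    case (elim l)
    then have "dist (V (l * 4) / V l) 1 < 1/2" by simp
    then have "V (l * 4) / V l > 1/2" unfolding dist_real_def by linarith
    with elim show ?case by (simp add: field_simps)
  qed
  then obtain b where b: "b > 0" "\<And>l. 0 < l \<Longrightarrow> l < b \<Longrightarrow> V l > 0 \<and> V l \<le> 2 * V (4 * l)"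
    unfolding eventually_at_right_field by auto
  have "(deriv ^^ 0) V field_differentiable at x" "(deriv ^^ 1) V field_differentiable at x"
    if "x > 0" for x
    using smooth that unfolding smooth_on_pos_def by blast+
  then have d: "V field_differentiable at x" "deriv V field_differentiable at x" if "x > 0" for x
    using that by simp_all
  show ?thesis
  \<comment> \<open>\<open>s\<close> is a real number below the possibly infinite \<open>S\<close>;
    halving \<open>b\<close> lets the non-strict bound by \<open>R\<close> imply the strict one by
    \<open>b\<close>.\<close>
  proof (rule that[of "min s (b/2)"], unfold_locales)
    fix x :: real assume x: "0 < x"  "x \<le> min s (b/2)"
    then have "ereal x < S"
      using s by (metis ereal_less_eq(3) min.boundedE order_le_less_trans)
    then show "deriv V x < 0" "deriv (deriv V) x > 0"
      using S x by auto
    show "V x > 0" using b x by auto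
  next
    show "V x \<le> 2 * V (4 * x)" if "0 < x" "4 * x \<le> min s (b / 2)" for x
      using b(2)[of x] that by auto
  qed (use s b d blowup in \<open>auto intro: field_differentiable_derivI\<close>)
qed

context collapsing_potential
begin

lemma V_continuous: "continuous_on {0<..} V"
  by (intro continuous_at_imp_continuous_on ballI DERIV_isCont[OF V_deriv]) auto

lemma V_antimono: "V y \<le> V x" if "0 < x" "x \<le> y" "y \<le> R"
proof (rule DERIV_nonpos_imp_nonincreasing[OF \<open>x \<le> y\<close>])
  fix z assume "x \<le> z" "z \<le> y"
  then show "\<exists>d. DERIV V z :> d \<and> d \<le> 0"
    using V_deriv[of z] V_decreasing[of z] that by (intro exI[of _ "deriv V z"]) auto
qed

lemma deriv_V_mono: "deriv V x \<le> deriv V y" if "0 < x" "x \<le> y" "y \<le> R"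
proof (rule DERIV_nonneg_imp_nondecreasing[OF \<open>x \<le> y\<close>])
  fix z assume "x \<le> z" "z \<le> y"
  then show "\<exists>d. DERIV (deriv V) z :> d \<and> d \<ge> 0"
    using V_deriv2[of z] V_convex[of z] that by (intro exI[of _ "deriv (deriv V) z"]) auto
qed

text \<open>By convexity every slope between \<open>x\<close> and \<open>y\<close> is at most the
  slope at \<open>z\<close>, so one reference slope serves all pairs to the left of
  \<open>z\<close>.\<close>

lemma V_drop:
  assumes "0 < x" "x < y" "y \<le> z" "z \<le> R"
  shows "- deriv V z * (y - x) \<le> V x - V y"
proof -
  obtain \<xi> where \<xi>: "x < \<xi>" "\<xi> < y" "V y - V x = (y - x) * deriv V \<xi>"
    using MVT2[OF \<open>x < y\<close>, of V "deriv V"] V_deriv assms by force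
  have "deriv V \<xi> * (y - x) \<le> deriv V z * (y - x)"
    using deriv_V_mono[of \<xi> z] \<xi> assms by (intro mult_right_mono) auto
  with \<xi>(3) show ?thesis by (simp add: algebra_simps)
qed

text \<open>Passing from \<open>4 * x\<close> to \<open>x\<close> at most doubles \<open>V\<close>
  while the other factor shrinks by 4, so the product does not grow. Induction over the scales
  \<open>R / 4 ^ n\<close> leads back to arguments between \<open>R / 4\<close> and
  \<open>R\<close>, where monotonicity gives the bound.\<close>

lemma x_times_V_bounded:
  obtains B where "\<And>x. 0 < x \<Longrightarrow> x \<le> R \<Longrightarrow> x * V x \<le> B"
proof -
  have *: "x * V x \<le> R * V (R / 4)" if "R / 4 ^ n \<le> x" "x \<le> R" for n x
    using that
  proof (induction n arbitrary: x)
    case 0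
    then have "x = R" using R_pos by simp
    then show ?case
      using V_antimono[of "R/4" R] R_pos by simp
  next
    case (Suc n)
    have "0 < R / 4 ^ Suc n" using R_pos by simp
    with Suc.prems have x: "x > 0" by linarith
    show ?case
    proof (cases "4 * x \<le> R")
      case True
      have "x * V x \<le> x * (2 * V (4 * x))"
        using V_quadruple[OF x True] x by (intro mult_left_mono) auto
      also have "\<dots> \<le> 4 * x * V (4 * x)"
        using V_pos[of "4 * x"] x True by simp
      also have "\<dots> \<le> R * V (R / 4)"
        by (rule Suc.IH) (use True Suc.prems in \<open>auto simp: field_simps\<close>)
      finally show ?thesis .
    next
      case False
      then show ?thesis
        using V_antimono[of "R/4" x] V_pos[of x] Suc.prems x R_pos by (intro mult_mono) auto
    qed
  qed
  show ?thesis
  proof (rule that)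
    fix x assume x: "0 < x" "x \<le> R"
    obtain n where "R / x < 4 ^ n"
      using real_arch_pow[of 4 "R/x"] by auto
    then have "R / 4 ^ n \<le> x" using x by (simp add: field_simps)
    then show "x * V x \<le> R * V (R / 4)" using * x by blast
  qed
qed

text \<open>Otherwise \<open>\<surd>V\<close> would be Lipschitz near \<open>0\<close>, hence bounded.\<close>
lemma deriv_V_dominates_sqrt:
  assumes "s > 0" "M > 0"
  obtains x where "0 < x" "x < s" "x \<le> R" "- deriv V x > M * sqrt (V x)"
proof (rule ccontr)
  assume "\<not> thesis"
  with that have *: "- deriv V x \<le> M * sqrt (V x)" if "0 < x" "x < s" "x \<le> R" for x
    using that by force
  define m where "m = min R (s/2)"
  have m: "0 < m" "m \<le> R" "m < s" using assms R_pos by (auto simp: m_def)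
  have bound: "sqrt (V x) \<le> sqrt (V m) + M * m" if x: "0 < x" "x \<le> m" for x
  proof -
    \<comment> \<open>The negated claim bounds the derivative of \<open>sqrt (V z)\<close> below by
      \<open>- M / 2\<close>, so the added linear term makes the sum nondecreasing.\<close>
    have "sqrt (V x) + M * x \<le> sqrt (V m) + M * m"
    proof (rule DERIV_nonneg_imp_nondecreasing[OF x(2)])
      fix z assume z: "x \<le> z" "z \<le> m"
      have pos: "V z > 0" using V_pos[of z] z x m by auto
      have "((\<lambda>z. sqrt (V z) + M * z) has_real_derivative deriv V z * (inverse (sqrt (V z)) / 2) + M) (at z)"
        using V_deriv[of z] z x pos by (auto intro!: derivative_eq_intros)
      moreover have "0 \<le> deriv V z * (inverse (sqrt (V z)) / 2) + M"
      proof -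
        have "- deriv V z \<le> 2 * (M * sqrt (V z))"
          using *[of z] pos z x m \<open>M > 0\<close> by (smt (verit) mult_nonneg_nonneg real_sqrt_ge_zero)
        then show ?thesis using pos by (simp add: field_simps)
      qed
      ultimately show "\<exists>d. DERIV (\<lambda>z. sqrt (V z) + M * z) z :> d \<and> 0 \<le> d" by blast
    qed
    moreover have "M * x \<ge> 0" using x assms by simp
    ultimately show ?thesis by linarith
  qed
  define C where "C = sqrt (V m) + M * m"
  have "\<forall>\<^sub>F x in at_right 0. V x > C\<^sup>2"
    using V_blowup by (simp add: filterlim_at_top_dense)
  moreover have "\<forall>\<^sub>F x in at_right 0. 0 < x \<and> x < m"
    using m by (auto simp: eventually_at_right_field)
  ultimately have "\<forall>\<^sub>F x in at_right (0::real). False"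
  proof eventually_elim
    case (elim x)
    have "sqrt (V x) \<le> C" using bound elim by (simp add: C_def)
    then have "V x \<le> C\<^sup>2" using sqrt_le_D by blast
    then show ?case using elim by simp
  qed
  then show False by simp
qed

section \<open>Radial collisions\<close>

lemma collision_acceleration:
  assumes "x \<noteq> 0" "GDERIV (\<lambda>y. V (norm y)) x :> a"
  shows "a = deriv V (norm x) *\<^sub>R sgn x"
proof -
  have "GDERIV (\<lambda>y. V (norm y)) x :> deriv V (norm x) *\<^sub>R sgn x"
    by (rule GDERIV_DERIV_compose[OF GDERIV_norm V_deriv]) (use \<open>x \<noteq> 0\<close> in auto)
  with assms(2) have "(\<lambda>h. h \<bullet> a) = (\<lambda>h. h \<bullet> (deriv V (norm x) *\<^sub>R sgn x))"
    unfolding gderiv_def by (rule has_derivative_unique)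
  then show ?thesis by (metis inner_commute vector_eq_rdot)
qed

text \<open>The force is the gradient of \<open>V\<close> itself and not of its negative, so kinetic
  energy minus \<open>V\<close> is conserved: both terms have derivative
  \<open>v t \<bullet> a t\<close>.\<close>

lemma energy_conserved:
  assumes "convex I"
    and u: "\<And>t. t \<in> I \<Longrightarrow> (u has_vector_derivative v t) (at t within I)"
    and v: "\<And>t. t \<in> I \<Longrightarrow> (v has_vector_derivative a t) (at t within I)"
    and a: "\<And>t. t \<in> I \<Longrightarrow> GDERIV (\<lambda>y. V (norm y)) (u t) :> a t"
  obtains h where "\<And>t. t \<in> I \<Longrightarrow> v t \<bullet> v t = 2 * (h + V (norm (u t)))"
proof -
  have "((\<lambda>t. v t \<bullet> v t / 2 - V (norm (u t))) has_real_derivative 0) (at t within I)"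
    if t: "t \<in> I" for t
  proof -
    have "((\<lambda>t. V (norm (u t))) has_derivative (\<lambda>h. (h *\<^sub>R v t) \<bullet> a t)) (at t within I)"
      using has_derivative_compose[OF u[OF t, unfolded has_vector_derivative_def]
          a[OF t, unfolded gderiv_def]] .
    then have "((\<lambda>t. V (norm (u t))) has_real_derivative v t \<bullet> a t) (at t within I)"
      by (simp add: has_field_derivative_def mult_commute_abs)
    moreover have "((\<lambda>t. v t \<bullet> v t) has_real_derivative v t \<bullet> a t + a t \<bullet> v t) (at t within I)"
      unfolding has_real_derivative_iff_has_vector_derivative
      by (rule bounded_bilinear.has_vector_derivative[OF bounded_bilinear_inner v[OF t] v[OF t]])
    ultimately show ?thesis
      by (auto intro!: derivative_eq_intros simp: inner_commute)
  qed
  then obtain h where "\<forall>t\<in>I. v t \<bullet> v t / 2 - V (norm (u t)) = h"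
    using has_field_derivative_zero_constant[OF \<open>convex I\<close>] by blast
  then show ?thesis using that[of h] by force
qed

text \<open>With zero angular momentum the velocity is parallel to the position, so the direction
  \<open>e\<close> never changes; \<open>p\<close> is the velocity along \<open>e\<close> and
  \<open>h\<close> the energy.\<close>

lemma collision_radial:
  assumes "T > 0" "collision_solution V T u"
  obtains e r p h where "norm e = 1"
    and "\<And>t. t \<in> {-T..<0} \<Longrightarrow> u t = r t *\<^sub>R e"
    and "\<And>t. t \<in> {-T..<0} \<Longrightarrow> r t > 0"
    and "\<And>t. t \<in> {-T..<0} \<Longrightarrow> (r has_real_derivative p t) (at t within {-T..<0})"
    and "continuous_on {-T..<0} p"
    and "\<And>t. t \<in> {-T..<0} \<Longrightarrow> (p t)\<^sup>2 = 2 * (h + V (r t))"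
    and "(r \<longlongrightarrow> 0) (at_left 0)"
proof -
  define I where "I = {-T..<0}"
  have I: "convex I" by (simp add: I_def)
  from assms(2) obtain v a where nz: "\<And>t. t \<in> I \<Longrightarrow> u t \<noteq> 0"
    and u: "\<And>t. t \<in> I \<Longrightarrow> (u has_vector_derivative v t) (at t within I)"
    and v: "\<And>t. t \<in> I \<Longrightarrow> (v has_vector_derivative a t) (at t within I)"
    and a: "\<And>t. t \<in> I \<Longrightarrow> GDERIV (\<lambda>y. V (norm y)) (u t) :> a t"
    and lim: "(u \<longlongrightarrow> 0) (at_left 0)"
    unfolding collision_solution_def I_def by metis
  obtain h where h: "\<And>t. t \<in> I \<Longrightarrow> v t \<bullet> v t = 2 * (h + V (norm (u t)))"
    using energy_conserved[OF I u v a] by blast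
  have "a t = (deriv V (norm (u t)) / norm (u t)) *\<^sub>R u t" if "t \<in> I" for t
    using collision_acceleration[OF nz a, OF that that] by (simp add: sgn_div_norm divide_inverse)
  with v have "\<And>t. t \<in> I \<Longrightarrow> (v has_vector_derivative (deriv V (norm (u t)) / norm (u t)) *\<^sub>R u t) (at t within I)"
    by metis
  from angular_momentum_conserved[OF I u this] obtain c
    where c: "\<And>t. t \<in> I \<Longrightarrow> u t $ 1 * v t $ 2 - u t $ 2 * v t $ 1 = c"
    by blast
  have lim_norm: "((\<lambda>t. norm (u t)) \<longlongrightarrow> 0) (at_left 0)"
    using tendsto_norm[OF lim] by simp
  have "c = 0"
  proof -
    obtain B where B: "\<And>x. 0 < x \<Longrightarrow> x \<le> R \<Longrightarrow> x * V x \<le> B"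
      using x_times_V_bounded by blast
    \<comment> \<open>\<open>F\<close> arises from
      \<open>c\<^sup>2 \<le> |u|\<^sup>2 |v|\<^sup>2\<close> by inserting the energy identity and
      spending one factor \<open>|u|\<close> on the bound \<open>|u| V(|u|) \<le> B\<close>; the
      remaining factor makes the term vanish in the limit.\<close>
    define F where "F t = 2 * h * (norm (u t))\<^sup>2 + 2 * norm (u t) * B" for t
    have "(F \<longlongrightarrow> 2 * h * 0\<^sup>2 + 2 * 0 * B) (at_left 0)"
      unfolding F_def by (intro tendsto_intros lim_norm)
    then have "(F \<longlongrightarrow> 0) (at_left 0)" by simp
    moreover have "\<forall>\<^sub>F t in at_left 0. c\<^sup>2 \<le> F t"
    proof -
      have "\<forall>\<^sub>F t in at_left 0. norm (u t) < R"
        using order_tendstoD(2)[OF lim_norm R_pos] .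
      moreover have "\<forall>\<^sub>F t in at_left 0. t \<in> I"
        unfolding I_def eventually_at_left_field using \<open>T > 0\<close> by (intro exI[of _ "-T"]) auto
      ultimately show ?thesis
      proof eventually_elim
        case (elim t)
        have "norm (u t) * V (norm (u t)) \<le> B"
          using B[of "norm (u t)"] elim nz by simp
        then have "norm (u t) * (norm (u t) * V (norm (u t))) \<le> norm (u t) * B"
          by (intro mult_left_mono) auto
        moreover have "c\<^sup>2 \<le> (norm (u t))\<^sup>2 * (2 * (h + V (norm (u t))))"
          using cross_squared_le[of "u t" "v t"] c h elim by (simp add: power2_norm_eq_inner)
        ultimately show ?case
          by (simp add: F_def algebra_simps power2_eq_square)
      qed
    qed
    ultimately have "c\<^sup>2 \<le> 0"
      by (intro tendsto_lowerbound[of F 0 "at_left 0"]) auto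
    then show ?thesis by simp
  qed
  with c have par: "(u t \<bullet> u t) *\<^sub>R v t = (u t \<bullet> v t) *\<^sub>R u t" if "t \<in> I" for t
    using cross_zero_imp_parallel that by metis
  define r where "r t = norm (u t)" for t
  have r_pos: "r t > 0" if "t \<in> I" for t
    using nz that by (simp add: r_def)
  have r_deriv: "(r has_real_derivative sgn (u t) \<bullet> v t) (at t within I)" if "t \<in> I" for t
  proof -
    have "(r has_derivative (\<lambda>h. (h *\<^sub>R v t) \<bullet> sgn (u t))) (at t within I)"
      unfolding r_def
      using has_derivative_compose[OF u[OF that, unfolded has_vector_derivative_def]
          GDERIV_norm[OF nz[OF that], unfolded gderiv_def]] .
    then show ?thesis
      by (simp add: has_field_derivative_def mult_commute_abs inner_commute)
  qed
  \<comment> \<open>The derivative of the unit vector \<open>u / |u|\<close> is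
    \<open>|u|^(-3)\<close> times the difference of the two sides of \<open>par\<close>.\<close>
  have "((\<lambda>t. inverse (r t) *\<^sub>R u t) has_vector_derivative 0) (at t within I)" if t: "t \<in> I" for t
  proof -
    have *: "((\<lambda>t. inverse (r t)) has_real_derivative - ((sgn (u t) \<bullet> v t) / (r t)\<^sup>2)) (at t within I)"
      using r_pos[OF t] by (auto intro!: derivative_eq_intros r_deriv[OF t] simp: field_simps power2_eq_square)
    have "inverse (r t) *\<^sub>R v t + - ((sgn (u t) \<bullet> v t) / (r t)\<^sup>2) *\<^sub>R u t
       = inverse (r t ^ 3) *\<^sub>R ((u t \<bullet> u t) *\<^sub>R v t - (u t \<bullet> v t) *\<^sub>R u t)"
      using r_pos[OF t]
      by (simp add: sgn_div_norm r_def flip: power2_norm_eq_inner)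
        (simp add: algebra_simps divide_simps power2_eq_square power3_eq_cube)
    also have "\<dots> = 0" using par[OF t] by simp
    finally show ?thesis
      using has_vector_derivative_scaleR[OF * u[OF t]] by simp
  qed
  then obtain e where e: "\<And>t. t \<in> I \<Longrightarrow> inverse (r t) *\<^sub>R u t = e"
    using has_vector_derivative_zero_constant[OF I] by blast
  have ue: "u t = r t *\<^sub>R e" if "t \<in> I" for t
    using e[OF that, symmetric] r_pos[OF that] by simp
  have "-T \<in> I" using \<open>T > 0\<close> by (simp add: I_def)
  have norm_e: "norm e = 1"
    using e[OF \<open>-T \<in> I\<close>, symmetric] r_pos[OF \<open>-T \<in> I\<close>] by (simp add: r_def)
  have sgn: "sgn (u t) = e" if "t \<in> I" for t
    using e[OF that] by (simp add: sgn_div_norm r_def)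
  \<comment> \<open>The velocity has no component normal to \<open>e\<close>, so
    \<open>(e \<bullet> v t)\<^sup>2\<close> is the full squared speed and the energy identity
    becomes a scalar law.\<close>
  have v_par: "v t = (e \<bullet> v t) *\<^sub>R e" if "t \<in> I" for t
  proof -
    have "e \<bullet> e = 1" using norm_e by (simp add: norm_eq_1)
    then have "(r t * r t) *\<^sub>R v t = (r t * r t) *\<^sub>R (e \<bullet> v t) *\<^sub>R e"
      using par[OF that] ue[OF that] by (simp add: mult_ac)
    then show ?thesis using r_pos[OF that] by (metis less_irrefl mult_pos_pos real_vector.scale_left_imp_eq)
  qed
  show ?thesis
  proof (rule that[of e r "\<lambda>t. e \<bullet> v t" h])
    show "continuous_on {-T..<0} (\<lambda>t. e \<bullet> v t)"
      using v unfolding I_def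
      by (intro continuous_intros continuous_on_vector_derivative) auto
    show "(e \<bullet> v t)\<^sup>2 = 2 * (h + V (r t))" if "t \<in> {-T..<0}" for t
    proof -
      have t: "t \<in> I" using that by (simp add: I_def)
      have "(e \<bullet> v t)\<^sup>2 = v t \<bullet> v t"
        using v_par[OF t] norm_e
        by (metis mult.right_neutral power2_norm_eq_inner norm_scaleR power2_abs)
      then show ?thesis using h[OF t] by (simp add: r_def)
    qed
    show "(r has_real_derivative e \<bullet> v t) (at t within {-T..<0})" if "t \<in> {-T..<0}" for t
      using r_deriv[of t] sgn[of t] that by (simp add: I_def)
    show "(r \<longlongrightarrow> 0) (at_left 0)" using lim_norm by (simp add: r_def[abs_def])
  qed (use norm_e ue r_pos in \<open>auto simp: I_def\<close>)
qed

end

section \<open>The radial motion up to the collision\<close>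

locale radial_collision = collapsing_potential +
  fixes T h :: real and r p :: "real \<Rightarrow> real"
  assumes T_pos: "T > 0"
    and r_pos: "\<And>t. t \<in> {-T..<0} \<Longrightarrow> r t > 0"
    and r_deriv: "\<And>t. t \<in> {-T..<0} \<Longrightarrow> (r has_real_derivative p t) (at t within {-T..<0})"
    and p_continuous: "continuous_on {-T..<0} p"
    and energy: "\<And>t. t \<in> {-T..<0} \<Longrightarrow> (p t)\<^sup>2 = 2 * (h + V (r t))"
    and r_lim: "(r \<longlongrightarrow> 0) (at_left 0)"
begin

lemma r_deriv_at: "(r has_real_derivative p t) (at t)" if "t \<in> {-T<..<0}"
  using r_deriv[of t] at_within_interior[of t "{-T..<0}"] that by auto

lemma r_continuous: "continuous_on {-T..<0} r"
  using r_deriv by (meson DERIV_continuous_on)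

text \<open>Where \<open>V (r t)\<close> exceeds \<open>\<bar>h\<bar>\<close> the energy law forbids
  \<open>p t = 0\<close>, so the continuous \<open>p\<close> keeps one sign. A positive sign would
  keep \<open>r\<close> away from its limit \<open>0\<close>.\<close>

lemma near_collision:
  obtains \<tau> where "0 < \<tau>" "\<tau> < T"
    and "\<And>t. t \<in> {-\<tau>..<0} \<Longrightarrow> r t \<le> R / 2"
    and "\<And>t. t \<in> {-\<tau>..<0} \<Longrightarrow> p t < 0"
    and "\<And>t. t \<in> {-\<tau>..<0} \<Longrightarrow> \<bar>h\<bar> < V (r t)"
proof -
  have ev: "\<forall>\<^sub>F t in at_left 0. t \<in> {-T<..<0}"
    unfolding eventually_at_left_field using T_pos by (intro exI[of _ "-T"]) auto
  have "filterlim r (at_right 0) (at_left 0)"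
    by (rule tendsto_imp_filterlim_at_right[OF r_lim], use ev in eventually_elim) (rule r_pos, auto)
  from filterlim_compose[OF V_blowup this] have "\<forall>\<^sub>F t in at_left 0. V (r t) > \<bar>h\<bar>"
    by (simp add: filterlim_at_top_dense)
  moreover have "\<forall>\<^sub>F t in at_left 0. r t < R / 2"
    using order_tendstoD(2)[OF r_lim, of "R / 2"] R_pos by simp
  ultimately have "\<forall>\<^sub>F t in at_left 0. V (r t) > \<bar>h\<bar> \<and> r t < R / 2 \<and> t \<in> {-T<..<0}"
    using ev by eventually_elim auto
  then obtain b where b: "b < 0" "\<And>t. b < t \<Longrightarrow> t < 0 \<Longrightarrow> V (r t) > \<bar>h\<bar> \<and> r t < R / 2 \<and> t \<in> {-T<..<0}"
    unfolding eventually_at_left_field by auto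
  \<comment> \<open>Halving keeps the closed left end \<open>-\<tau>\<close> strictly between
    \<open>b\<close> and \<open>0\<close>.\<close>
  define \<tau> where "\<tau> = - b / 2"
  have \<tau>: "V (r t) > \<bar>h\<bar> \<and> r t < R / 2 \<and> t \<in> {-T<..<0}" if "t \<in> {-\<tau>..<0}" for t
    using b that by (auto simp: \<tau>_def)
  have "\<tau> > 0" using b by (simp add: \<tau>_def)
  then have "\<tau> < T" using \<tau>[of "-\<tau>"] by auto
  have "p t < 0" if t: "t \<in> {-\<tau>..<0}" for t
  proof (rule ccontr)
    assume "\<not> p t < 0"
    have nz: "p s \<noteq> 0" if "s \<in> {-\<tau>..<0}" for s
      using energy[of s] \<tau>[OF that] by auto
    have p_pos: "p s > 0" if "s \<in> {t..<0}" for s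
    proof (rule ccontr)
      assume "\<not> p s > 0"
      then have "\<exists>x\<ge>t. x \<le> s \<and> p x = 0"
        using \<open>\<not> p t < 0\<close> that t \<open>\<tau> < T\<close>
        by (intro IVT2' continuous_on_subset[OF p_continuous]) auto
      then show False using nz that t by auto
    qed
    have "r t \<le> r s" if "s \<in> {t..<0}" for s
    proof (rule DERIV_nonneg_imp_nondecreasing[of t s r])
      fix x assume x: "t \<le> x" "x \<le> s"
      show "\<exists>d. DERIV r x :> d \<and> 0 \<le> d"
        using r_deriv_at[of x] p_pos[of x] x that t \<open>\<tau> < T\<close> by (intro exI[of _ "p x"]) auto
    qed (use that in auto)
    then have "\<forall>\<^sub>F s in at_left 0. r t \<le> r s"
      unfolding eventually_at_left_field using t by (intro exI[of _ t]) auto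
    then have "r t \<le> 0"
      by (intro tendsto_lowerbound[OF r_lim]) auto
    then show False using r_pos[of t] t \<open>\<tau> < T\<close> by auto
  qed
  then show ?thesis using that[of \<tau>] \<tau> \<open>\<tau> > 0\<close> \<open>\<tau> < T\<close> by force
qed

text \<open>The value of \<open>r\<close> at \<open>0\<close> is unspecified; its limit is put there
  so that the fundamental theorem and the intermediate value theorem apply up to the
  collision.\<close>

lemma r_extended_continuous: "continuous_on {-T..0} (\<lambda>t. if t = 0 then 0 else r t)"
  unfolding continuous_on_eq_continuous_within
proof
  fix t assume t: "t \<in> {-T..0}"
  show "continuous (at t within {-T..0}) (\<lambda>t. if t = 0 then 0 else r t)"
  proof (cases "t = 0")
    case True
    have "at 0 within {-T..0} = at_left 0"
      using T_pos by (simp add: at_within_Icc_at_left)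
    moreover have "((\<lambda>t. if t = 0 then 0 else r t) \<longlongrightarrow> 0) (at_left 0)"
      using r_lim by (rule tendsto_cong[THEN iffD1, rotated]) (auto simp: eventually_at_left_field intro: exI[of _ "-1"])
    ultimately show ?thesis using True by (simp add: continuous_within)
  next
    case False
    then have t': "t \<in> {-T..<0}" using t by auto
    have "continuous (at t within {-T..<0}) r"
      using r_continuous t' by (simp add: continuous_on_eq_continuous_within)
    moreover have "at t within {-T..0} = at t within {-T..<0}"
      by (rule at_within_nhd[of _ "{..<0}"]) (use t' in auto)
    ultimately have "continuous (at t within {-T..0}) r" by simp
    then show ?thesis
      by (rule continuous_transform_within[where \<delta>="-t"]) (use t' in \<open>auto simp: dist_real_def\<close>)
  qed
qed

text \<open>Boundedness of \<open>x V(x)\<close> gives \<open>p\<^sup>2 \<le> K (- p) / \<surd>r\<close> near the collision, and the right-hand side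
  is the derivative of \<open>- 2 K \<surd>r\<close>.\<close>
lemma p_squared_integrable: "(\<lambda>t. (p t)\<^sup>2) integrable_on {-T..0}"
proof -
  obtain \<tau> where \<tau>: "0 < \<tau>" "\<tau> < T"
    and rR: "\<And>t. t \<in> {-\<tau>..<0} \<Longrightarrow> r t \<le> R / 2"
    and p_neg: "\<And>t. t \<in> {-\<tau>..<0} \<Longrightarrow> p t < 0"
    and hV: "\<And>t. t \<in> {-\<tau>..<0} \<Longrightarrow> \<bar>h\<bar> < V (r t)"
    using near_collision by blast
  obtain B where B: "\<And>x. 0 < x \<Longrightarrow> x \<le> R \<Longrightarrow> x * V x \<le> B"
    using x_times_V_bounded by blast
  have "B > 0" using B[OF R_pos order.refl] V_pos[OF R_pos order.refl] R_pos
    by (smt (verit) mult_pos_pos)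
  \<comment> \<open>\<open>G\<close> is an antiderivative of \<open>g\<close> that stays continuous
    up to the collision although \<open>g\<close> may blow up there; the constant \<open>K\<close>
    is \<open>2 * sqrt B\<close>.\<close>
  define g where "g t = 2 * sqrt B * (- p t) / sqrt (r t)" for t
  define G where "G t = - 4 * sqrt B * sqrt (if t = 0 then 0 else r t)" for t
  have "(g has_integral (G 0 - G (-\<tau>))) {-\<tau>..0}"
  proof (rule fundamental_theorem_of_calculus_interior)
    show "continuous_on {-\<tau>..0} G"
      unfolding G_def
      by (intro continuous_intros continuous_on_subset[OF r_extended_continuous]) (use \<tau> in auto)
    fix t assume t: "t \<in> {-\<tau><..<0}"
    have "((\<lambda>t. - 4 * sqrt B * sqrt (r t)) has_real_derivative g t) (at t)"
      using r_deriv_at[of t] r_pos[of t] t \<tau>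
      by (auto intro!: derivative_eq_intros simp: g_def field_simps)
    then have "(G has_real_derivative g t) (at t)"
      by (rule DERIV_cong_ev[THEN iffD1, rotated -1])
        (use t in \<open>auto simp: G_def eventually_nhds intro!: exI[of _ "{..<0}"]\<close>)
    then show "(G has_vector_derivative g t) (at t)"
      by (simp add: has_real_derivative_iff_has_vector_derivative)
  qed (use \<tau> in auto)
  then have "g integrable_on {-\<tau>..0}" by blast
  then have g: "g integrable_on {-\<tau>..<0}"
    by (rule integrable_spike_set) (auto intro: negligible_subset[of "{0}"])
  have "(\<lambda>t. (p t)\<^sup>2) integrable_on {-\<tau>..<0}"
  proof (rule measurable_bounded_by_integrable_imp_integrable[OF _ g])
    show "(\<lambda>t. (p t)\<^sup>2) \<in> borel_measurable (lebesgue_on {-\<tau>..<0})"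
      by (intro continuous_imp_measurable_on_sets_lebesgue continuous_intros
          continuous_on_subset[OF p_continuous]) (use \<tau> in auto)
    fix t assume t: "t \<in> {-\<tau>..<0}"
    have r: "0 < r t" "r t \<le> R" using r_pos[of t] rR[OF t] t \<tau> R_pos by auto
    \<comment> \<open>The bound \<open>\<bar>h\<bar> < V (r t)\<close> absorbs the energy constant
      into the factor 4.\<close>
    have "(p t)\<^sup>2 \<le> 4 * V (r t)"
      using energy[of t] hV[OF t] t \<tau> by auto
    also have "\<dots> \<le> 4 * B / r t"
      using B[OF r] r by (simp add: field_simps)
    finally have "sqrt ((p t)\<^sup>2) \<le> sqrt (4 * B / r t)"
      by (rule real_sqrt_le_mono)
    then have "- p t \<le> 2 * sqrt B / sqrt (r t)"
      using p_neg[OF t] by (simp add: real_sqrt_divide real_sqrt_mult)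
    then have "(- p t) * (- p t) \<le> (- p t) * (2 * sqrt B / sqrt (r t))"
      using p_neg[OF t] by (intro mult_left_mono) auto
    then show "norm ((p t)\<^sup>2) \<le> g t"
      by (simp add: g_def power2_eq_square mult_ac)
  qed auto
  then have "(\<lambda>t. (p t)\<^sup>2) integrable_on {-\<tau>..0}"
    by (rule integrable_spike_set) (auto intro: negligible_subset[of "{0}"])
  moreover have "(\<lambda>t. (p t)\<^sup>2) integrable_on {-T..-\<tau>}"
    by (intro integrable_continuous_real continuous_intros continuous_on_subset[OF p_continuous])
      (use \<tau> in auto)
  ultimately show ?thesis
    using \<tau> by (intro Henstock_Kurzweil_Integration.integrable_combine[of "-T" "-\<tau>" 0]) auto
qed

section \<open>The perturbed transmission solution\<close>

definition radius :: "real \<Rightarrow> real" where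
  "radius t = (if t = 0 then 0 else r (- \<bar>t\<bar>))"

text \<open>The coordinate along \<open>e\<close>: \<open>r t\<close> before the collision and
  \<open>- r (- t)\<close> after it, which is the transmission rule.\<close>

definition position :: "real \<Rightarrow> real" where
  "position t = - sgn t * radius t"

text \<open>The signed derivative of \<open>position\<close> away from the collision; it is even
  because the signs of the reflections in time and in space cancel.\<close>

definition speed :: "real \<Rightarrow> real" where
  "speed t = p (- \<bar>t\<bar>)"

lemma radius_pos: "t \<in> {-T..T} \<Longrightarrow> t \<noteq> 0 \<Longrightarrow> radius t > 0"
  using r_pos[of "- \<bar>t\<bar>"] by (auto simp: radius_def)

lemma radius_continuous: "continuous_on {-T..T} radius"
proof -
  have "continuous_on {-T..T} ((\<lambda>t. if t = 0 then 0 else r t) \<circ> (\<lambda>t. - \<bar>t\<bar>))"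
    by (intro continuous_on_compose continuous_intros continuous_on_subset[OF r_extended_continuous]) auto
  then show ?thesis
    by (simp add: radius_def[abs_def] o_def)
qed

lemma position_squared: "(position t)\<^sup>2 = (radius t)\<^sup>2"
  by (simp add: position_def radius_def power_mult_distrib sgn_if)

lemma position_continuous: "continuous_on {-T..T} position"
proof -
  have "continuous_on ({-T..0} \<union> {0..T}) position"
  proof (rule continuous_on_closed_Un)
    have "continuous_on {-T..0} radius" "continuous_on {0..T} (\<lambda>t. - radius t)"
      using T_pos by (auto intro!: continuous_intros continuous_on_subset[OF radius_continuous])
    then show "continuous_on {-T..0} position" "continuous_on {0..T} position"
      by (auto elim!: continuous_on_eq simp: position_def radius_def sgn_if)
  qed auto
  moreover have "{-T..0} \<union> {0..T} = {-T..T}" using T_pos by auto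
  ultimately show ?thesis by simp
qed

lemma position_deriv:
  assumes "t \<in> {-T<..<T} - {0}"
  shows "(position has_real_derivative speed t) (at t)"
proof (cases "t < 0")
  case True
  show ?thesis
    by (rule has_field_derivative_transform_within_open[of r _ _ "{..<0}"])
      (use True assms r_deriv_at[of t] in \<open>auto simp: speed_def position_def radius_def\<close>)
next
  case False
  then have "((\<lambda>s. - r (- s)) has_real_derivative speed t) (at t)"
    using assms DERIV_minus[OF DERIV_mirror[THEN iffD1, of r "speed t" "t"]] r_deriv_at[of "-t"]
    by (auto simp: speed_def)
  then show ?thesis
    by (rule has_field_derivative_transform_within_open[of _ _ _ "{0<..}"])
      (use False assms in \<open>auto simp: position_def radius_def\<close>)
qed

lemma speed_squared: "t \<in> {-T..T} \<Longrightarrow> t \<noteq> 0 \<Longrightarrow> (speed t)\<^sup>2 = 2 * (h + V (radius t))"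
  using energy[of "- \<bar>t\<bar>"] by (auto simp: speed_def radius_def)

lemma speed_squared_integrable: "(\<lambda>t. (speed t)\<^sup>2) integrable_on {-T..T}"
proof (rule Henstock_Kurzweil_Integration.integrable_combine[of _ 0])
  show "(\<lambda>t. (speed t)\<^sup>2) integrable_on {-T..0}"
    by (rule integrable_eq[OF p_squared_integrable]) (auto simp: speed_def)
  have "(\<lambda>t. (p (- t))\<^sup>2) integrable_on {-0..-(-T)}"
    by (rule Henstock_Kurzweil_Integration.integrable_reflect_real[where f = "\<lambda>t. (p t)\<^sup>2" and a = "-T" and b = 0,
          THEN iffD2, OF p_squared_integrable])
  then have "(\<lambda>t. (p (- t))\<^sup>2) integrable_on {0..T}" by simp
  then show "(\<lambda>t. (speed t)\<^sup>2) integrable_on {0..T}"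
    by (rule integrable_eq) (auto simp: speed_def)
qed (use T_pos in auto)

text \<open>The case \<open>\<delta> = 0\<close> covers the transmission solution itself.\<close>
context
  fixes e n :: "real^2" and w :: "real \<Rightarrow> real^2" and \<tau> \<delta> :: real
  assumes orthonormal: "norm e = 1" "norm n = 1" "e \<bullet> n = 0"
    and \<tau>: "0 < \<tau>" "\<tau> < T"
    and w: "\<And>t. t \<in> {-T..T} \<Longrightarrow> w t = position t *\<^sub>R e + bump \<tau> \<delta> t *\<^sub>R n"
begin

lemma perturbed_path_deriv:
  assumes "t \<in> {-T<..<T} - {-\<tau>, 0, \<tau>}"
  shows "(w has_vector_derivative speed t *\<^sub>R e + bump_deriv \<tau> \<delta> t *\<^sub>R n) (at t)"
proof (rule has_vector_derivative_transform_within_open)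
  have "(position has_vector_derivative speed t) (at t)"
    "(bump \<tau> \<delta> has_vector_derivative bump_deriv \<tau> \<delta> t) (at t)"
    using position_deriv[of t] bump_has_derivative[of \<tau> t \<delta>] assms \<tau>
    by (auto simp: has_real_derivative_iff_has_vector_derivative)
  from this[THEN bounded_linear.has_vector_derivative[OF bounded_linear_scaleR_left]]
  show "((\<lambda>t. position t *\<^sub>R e + bump \<tau> \<delta> t *\<^sub>R n) has_vector_derivative
      speed t *\<^sub>R e + bump_deriv \<tau> \<delta> t *\<^sub>R n) (at t)"
    by (rule has_vector_derivative_add)
  show "t \<in> {-T<..<T}" using assms by auto
qed (use w in auto)

lemma perturbed_path_H1: "H1_path T w"
proof (rule H1_pathI[of "{-\<tau>, 0, \<tau>}", OF _ _ perturbed_path_deriv])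
  have "continuous_on {-T..T} (\<lambda>t. position t *\<^sub>R e + bump \<tau> \<delta> t *\<^sub>R n)"
    unfolding bump_def using \<tau> by (intro continuous_intros position_continuous) auto
  then show "continuous_on {-T..T} w"
    by (rule continuous_on_eq) (use w in auto)
  show "(\<lambda>t. (norm (speed t *\<^sub>R e + bump_deriv \<tau> \<delta> t *\<^sub>R n))\<^sup>2) integrable_on {-T..T}"
    unfolding norm_orthonormal_combination[OF orthonormal]
    using integrable_add[OF speed_squared_integrable has_integral_integrable[OF bump_deriv_squared_has_integral[OF \<tau>]]]
    by simp
qed (use T_pos in auto)

text \<open>The normal displacement adds a square to both the squared velocity and the squared
  radius. Left out are the end points, as \<open>velocity\<close> is a two-sided derivative, the
  kinks of the tent, and the collision time, where the unperturbed path has infinite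
  potential.\<close>

lemma perturbed_path_lagrangian:
  assumes "t \<in> {-T..T} - {-T, -\<tau>, 0, \<tau>, T}"
  shows "lagrangian V w t =
    ereal (((speed t)\<^sup>2 + (bump_deriv \<tau> \<delta> t)\<^sup>2) / 2 + V (sqrt ((radius t)\<^sup>2 + (bump \<tau> \<delta> t)\<^sup>2)))"
proof -
  have "velocity w t = speed t *\<^sub>R e + bump_deriv \<tau> \<delta> t *\<^sub>R n"
    unfolding velocity_def by (rule vector_derivative_at[OF perturbed_path_deriv]) (use assms in auto)
  then have v: "(norm (velocity w t))\<^sup>2 = (speed t)\<^sup>2 + (bump_deriv \<tau> \<delta> t)\<^sup>2"
    by (simp add: norm_orthonormal_combination[OF orthonormal])
  have wt: "norm (w t) = sqrt ((radius t)\<^sup>2 + (bump \<tau> \<delta> t)\<^sup>2)"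
    using w[of t] assms by (simp add: norm_orthonormal_combination[OF orthonormal] position_squared)
  have "radius t > 0"
    using radius_pos[of t] assms by auto
  then have "norm (w t) > 0"
    unfolding wt by (simp add: add_pos_nonneg)
  then have "w t \<noteq> 0" by auto
  then show ?thesis
    by (simp add: lagrangian_def v wt)
qed

lemma perturbed_path_action:
  assumes "f absolutely_integrable_on {-T..T}"
    and "\<And>t. t \<in> {-T..T} - {0} \<Longrightarrow>
      f t = ((speed t)\<^sup>2 + (bump_deriv \<tau> \<delta> t)\<^sup>2) / 2 + V (sqrt ((radius t)\<^sup>2 + (bump \<tau> \<delta> t)\<^sup>2))"
  shows "action V T w = ereal (integral {-T..T} f)"
  by (rule action_eq_integral[of _ _ "{-T, -\<tau>, 0, \<tau>, T}"])
    (use assms perturbed_path_lagrangian in auto)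

end

text \<open>With \<open>\<delta> = \<rho> / 2\<close>, the potential gains at least \<open>- V'(\<rho>) \<rho> / 32\<close> while the radius
  descends from \<open>\<rho> / 2\<close> to \<open>\<rho> / 4\<close>, which takes a time of at least \<open>\<rho> / (12 \<surd>V(\<rho>))\<close>; the kinetic
  cost is \<open>\<delta>\<^sup>2 / \<tau>\<close>.\<close>
lemma bump_lowers_action:
  obtains \<tau> \<delta> f where "0 < \<tau>" "\<tau> < T"
    and "f absolutely_integrable_on {-T..T}"
    and "\<And>t. t \<in> {-T..T} - {0} \<Longrightarrow>
      f t = ((speed t)\<^sup>2 + (bump_deriv \<tau> \<delta> t)\<^sup>2) / 2 + V (sqrt ((radius t)\<^sup>2 + (bump \<tau> \<delta> t)\<^sup>2))"
    and "integral {-T..T} f < integral {-T..T} (\<lambda>t. (speed t)\<^sup>2 - h)"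
proof -
  obtain \<tau> where \<tau>: "0 < \<tau>" "\<tau> < T"
    and rR: "\<And>t. t \<in> {-\<tau>..<0} \<Longrightarrow> r t \<le> R / 2"
    and p_neg: "\<And>t. t \<in> {-\<tau>..<0} \<Longrightarrow> p t < 0"
    and hV: "\<And>t. t \<in> {-\<tau>..<0} \<Longrightarrow> \<bar>h\<bar> < V (r t)"
    using near_collision by blast
  have r\<tau>: "r (-\<tau>/2) > 0" using r_pos \<tau> by auto
  \<comment> \<open>The constant 96 is 32 * 12 / 4: it balances the cost
    \<open>\<rho>\<^sup>2 / (4 * \<tau>)\<close> against a gain
    \<open>- deriv V \<rho> * (\<rho> / 32)\<close> lasting for the time
    \<open>\<rho> / (12 * sqrt (V \<rho>))\<close>.\<close>
  obtain \<rho> where \<rho>: "0 < \<rho>" "\<rho> < r (-\<tau>/2)" "\<rho> \<le> R" "- deriv V \<rho> > (96/\<tau>) * sqrt (V \<rho>)"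
    using deriv_V_dominates_sqrt[OF r\<tau>, of "96/\<tau>"] \<tau> by auto
  define \<delta> where "\<delta> = \<rho> / 2"
  have \<delta>: "\<delta> > 0" using \<rho> by (simp add: \<delta>_def)
  have r_antimono: "r t \<le> r s" if "-\<tau> \<le> s" "s \<le> t" "t < 0" for s t
  proof (rule DERIV_nonpos_imp_nonincreasing[OF \<open>s \<le> t\<close>])
    fix x assume "s \<le> x" "x \<le> t"
    then show "\<exists>d. DERIV r x :> d \<and> d \<le> 0"
      using r_deriv_at[of x] p_neg[of x] that \<tau> by (intro exI[of _ "p x"]) auto
  qed
  define r0 where "r0 t = (if t = 0 then 0 else r t)" for t
  have r0: "continuous_on {a..0} r0" if "a \<ge> -T" for a
    unfolding r0_def by (rule continuous_on_subset[OF r_extended_continuous]) (use that in auto)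
  \<comment> \<open>As \<open>\<rho>\<close> lies below \<open>r (-\<tau>/2)\<close>, the radius
    passes \<open>\<rho>/2\<close> and then \<open>\<rho>/4\<close> no earlier than
    \<open>-\<tau>/2\<close>, where the tent has at least half its height.\<close>
  obtain a where a: "-\<tau>/2 \<le> a" "a \<le> 0" "r0 a = \<rho>/2"
    using IVT2'[of r0 0 "\<rho>/2" "-\<tau>/2"] r0[of "-\<tau>/2"] \<rho> \<tau> by (auto simp: r0_def)
  obtain b where b: "a \<le> b" "b \<le> 0" "r0 b = \<rho>/4"
    using IVT2'[of r0 0 "\<rho>/4" a] r0[of a] \<rho> \<tau> a by (auto simp: r0_def)
  have ab: "a < b" "b < 0" "r a = \<rho>/2" "r b = \<rho>/4"
    using a b \<rho> by (auto simp: r0_def less_le split: if_splits)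
  define S where "S = sqrt (V \<rho>)"
  have S: "S > 0" "S\<^sup>2 = V \<rho>" using V_pos[of \<rho>] \<rho> by (auto simp: S_def)
  have time: "\<rho> / (12 * S) \<le> b - a"
  proof -
    \<comment> \<open>At the mean value point, \<open>p\<^sup>2 \<le> 4 V(r) \<le> 4 V(\<rho>/4)
      \<le> 8 V(\<rho>) \<le> 9 S\<^sup>2\<close>, so a descent by \<open>\<rho>/4\<close> at mean
      speed at most \<open>3 * S\<close> takes at least the claimed time.\<close>
    obtain \<xi> where \<xi>: "a < \<xi>" "\<xi> < b" "r b - r a = (b - a) * p \<xi>"
      using MVT2[OF ab(1), of r p] r_deriv_at a ab \<tau> by force
    have \<xi>': "\<xi> \<in> {-\<tau>..<0}" using \<xi> a ab \<tau> by auto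
    have "\<rho>/4 \<le> r \<xi>" using r_antimono[of \<xi> b] \<xi> \<xi>' ab by auto
    then have "V (r \<xi>) \<le> V (\<rho>/4)"
      using V_antimono[of "\<rho>/4" "r \<xi>"] rR[OF \<xi>'] R_pos \<rho> by auto
    also have "\<dots> \<le> 2 * V \<rho>"
      using V_quadruple[of "\<rho>/4"] \<rho> by simp
    finally have "(- p \<xi>)\<^sup>2 \<le> (3 * S)\<^sup>2"
      using energy[of \<xi>] hV[OF \<xi>'] \<xi>' \<tau> S(2) V_pos[of \<rho>] \<rho> by (simp add: power_mult_distrib)
    then have "- p \<xi> \<le> 3 * S"
      by (rule power2_le_imp_le) (use S in simp)
    then have "(b - a) * (- p \<xi>) \<le> (b - a) * (3 * S)"
      using ab by (intro mult_left_mono) auto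
    then have "\<rho>/4 \<le> (b - a) * (3 * S)"
      using \<xi>(3) ab by simp
    then show ?thesis using S by (simp add: field_simps)
  qed
  define \<kappa> where "\<kappa> = - deriv V \<rho> * (\<rho> / 32)"
  have \<kappa>: "\<kappa> > 0" using V_decreasing[of \<rho>] \<rho> by (simp add: \<kappa>_def mult_neg_pos)
  have "\<delta>\<^sup>2 / \<tau> < \<kappa> * (b - a)"
  proof -
    have "\<delta>\<^sup>2 / \<tau> = (96/\<tau> * S) * (\<rho> / 32) * (\<rho> / (12 * S))"
      using S \<tau> by (simp add: \<delta>_def field_simps power2_eq_square)
    also have "\<dots> < \<kappa> * (\<rho> / (12 * S))"
      unfolding \<kappa>_def using \<rho> S by (intro mult_strict_right_mono) (auto simp: S_def)
    also have "\<dots> \<le> \<kappa> * (b - a)"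
      using time \<kappa> by (intro mult_left_mono) auto
    finally show ?thesis .
  qed
  define W where "W t = sqrt ((radius t)\<^sup>2 + (bump \<tau> \<delta> t)\<^sup>2)" for t
  have bump0: "bump \<tau> \<delta> 0 = \<delta>" by (simp add: bump_def)
  \<comment> \<open>At \<open>t = 0\<close> the radius vanishes and the height of the tent keeps the
    path off the origin; hence its potential is continuous on the whole interval.\<close>
  have W_pos: "W t > 0" if "t \<in> {-T..T}" for t
    using radius_pos[OF that] \<delta> bump0 unfolding W_def
    by (cases "t = 0") (auto simp: add_pos_nonneg add_nonneg_pos)
  have "continuous_on {-T..T} (\<lambda>t. V (W t))"
  proof (rule continuous_on_compose2[OF V_continuous])
    show "continuous_on {-T..T} W"
      unfolding W_def bump_def using \<tau> by (intro continuous_intros radius_continuous) auto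
  qed (use W_pos in auto)
  then have VW: "(\<lambda>t. V (W t)) absolutely_integrable_on {-T..T}"
    by (rule absolutely_integrable_continuous_real)
  have speed2: "(\<lambda>t. (speed t)\<^sup>2) absolutely_integrable_on {-T..T}"
    using speed_squared_integrable by (rule nonnegative_absolutely_integrable_1) simp
  note bump2 = bump_deriv_squared_has_integral[OF \<tau>, of \<delta>]
  have bump2': "(\<lambda>t. (bump_deriv \<tau> \<delta> t)\<^sup>2) absolutely_integrable_on {-T..T}"
    using has_integral_integrable[OF bump2] by (rule nonnegative_absolutely_integrable_1) simp
  define f where "f t = ((speed t)\<^sup>2 + (bump_deriv \<tau> \<delta> t)\<^sup>2) / 2 + V (W t)" for t
  have f: "f absolutely_integrable_on {-T..T}"
    unfolding f_def by (intro set_integral_add set_integrable_divide speed2 bump2' VW)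
  \<comment> \<open>By the energy law \<open>(speed t)\<^sup>2 - h\<close> is the Lagrangian of the
    unperturbed path off the collision, so \<open>g\<close> is the action density saved
    there.\<close>
  define g where "g t = ((speed t)\<^sup>2 - h) - f t" for t
  have fi: "f integrable_on {-T..T}"
    using f by (rule set_lebesgue_integral_eq_integral)
  have si: "(\<lambda>t. (speed t)\<^sup>2 - h) integrable_on {-T..T}"
    by (intro integrable_diff speed_squared_integrable) auto
  have g: "(g has_integral (integral {-T..T} (\<lambda>t. (speed t)\<^sup>2 - h) - integral {-T..T} f)) {-T..T}"
    unfolding g_def by (intro has_integral_diff integrable_integral fi si)
  \<comment> \<open>A lower bound for the saving: the potential gain is kept only on
    \<open>{a..b}\<close>, while the kinetic cost is charged in full.\<close>
  define k where "k t = (if t \<in> {a..b} then \<kappa> else 0) - (bump_deriv \<tau> \<delta> t)\<^sup>2 / 2" for t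
  have "((\<lambda>t. if t \<in> {a..b} then \<kappa> else 0) has_integral \<kappa> * (b - a)) {-T..T}"
    using has_integral_const_real[of \<kappa> a b] a ab \<tau>
    by (subst has_integral_restrict) (auto simp: mult.commute)
  then have "(k has_integral (\<kappa> * (b - a) - (2 * \<delta>\<^sup>2 / \<tau>) / 2)) {-T..T}"
    unfolding k_def by (intro has_integral_diff has_integral_divide bump2)
  \<comment> \<open>At \<open>t = 0\<close> the energy law says nothing; changing \<open>k\<close>
    at this one point makes the comparison with \<open>g\<close> hold everywhere.\<close>
  then have k: "((\<lambda>t. if t = 0 then g 0 else k t) has_integral (\<kappa> * (b - a) - (2 * \<delta>\<^sup>2 / \<tau>) / 2)) {-T..T}"
    by (rule has_integral_spike_finite[rotated 2, of _ _ _ "{0}"]) auto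
  have k_le: "k t \<le> g t" if t: "t \<in> {-T..T}" "t \<noteq> 0" for t
  proof -
    have gt: "g t = V (radius t) - V (W t) - (bump_deriv \<tau> \<delta> t)\<^sup>2 / 2"
      using speed_squared[OF t] by (simp add: g_def f_def field_simps)
    have rad: "radius t > 0" using radius_pos[OF t] .
    have "(if t \<in> {a..b} then \<kappa> else 0) \<le> V (radius t) - V (W t)"
    proof (cases "\<bar>t\<bar> \<le> \<tau>")
      case False
      then have "W t = radius t" "t \<notin> {a..b}"
        using a ab \<tau> rad by (auto simp: W_def bump_def field_simps)
      then show ?thesis by auto
    next
      case True
      have bt: "0 \<le> bump \<tau> \<delta> t" "bump \<tau> \<delta> t \<le> \<delta>"
        using True \<tau> \<delta> by (auto simp: bump_def mult_left_le)
      have radR: "radius t \<le> R/2"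
        using rR[of "- \<bar>t\<bar>"] True t by (auto simp: radius_def)
      have "W t \<le> radius t + bump \<tau> \<delta> t"
        unfolding W_def using bt rad by (intro sqrt_sum_squares_le_sum) auto
      then have WR: "W t \<le> R"
        using radR bt \<rho> by (simp add: \<delta>_def)
      have radW: "radius t \<le> W t"
        unfolding W_def by simp
      show ?thesis
      proof (cases "t \<in> {a..b}")
        case False
        then show ?thesis using V_antimono[OF rad radW WR] by auto
      next
        case True
        then have t': "t < 0" "-\<tau>/2 \<le> t" using a ab by auto
        then have rad_r: "radius t = r t" by (simp add: radius_def)
        have rt: "r t \<le> \<rho>/2" using r_antimono[of a t] True a ab t' \<tau> by auto
        have "1/2 \<le> 1 - \<bar>t\<bar> / \<tau>" using t' \<tau> by (simp add: field_simps)
        then have "\<delta> * (1/2) \<le> \<delta> * max 0 (1 - \<bar>t\<bar> / \<tau>)"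
          using \<delta> by (intro mult_left_mono max.coboundedI2) linarith+
        then have b4: "bump \<tau> \<delta> t \<ge> \<rho>/4" by (simp add: bump_def \<delta>_def)
        have W2: "(W t)\<^sup>2 = (radius t)\<^sup>2 + (bump \<tau> \<delta> t)\<^sup>2" by (simp add: W_def)
        have W\<rho>: "W t \<le> \<rho>"
          using \<open>W t \<le> radius t + bump \<tau> \<delta> t\<close> rt bt rad_r by (simp add: \<delta>_def)
        \<comment> \<open>The difference of squares \<open>W\<^sup>2 - radius\<^sup>2\<close> is at
          least \<open>(\<rho>/4)\<^sup>2\<close>, and \<open>W + radius\<close> is at most
          \<open>2 * \<rho>\<close>.\<close>
        have gap: "\<rho>/32 \<le> W t - radius t"
        proof -
          have "(\<rho>/4)\<^sup>2 \<le> (bump \<tau> \<delta> t)\<^sup>2" using b4 \<rho> by (intro power_mono) auto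
          also have "\<dots> = (W t - radius t) * (W t + radius t)"
            using W2 by (simp add: power2_eq_square algebra_simps)
          also have "\<dots> \<le> (W t - radius t) * (2 * \<rho>)"
            using radW W\<rho> by (intro mult_left_mono) auto
          finally have "\<rho> * (\<rho>/32) \<le> \<rho> * (W t - radius t)"
            by (simp add: power2_eq_square algebra_simps)
          then show ?thesis using \<rho> by (simp only: mult_le_cancel_left_pos)
        qed
        \<comment> \<open>The descent of \<open>V\<close> is least steep at \<open>\<rho>\<close>
          among the points up to \<open>\<rho>\<close>, so the slope there bounds the drop from
          below.\<close>
        have "- deriv V \<rho> * (\<rho>/32) \<le> - deriv V \<rho> * (W t - radius t)"
          using gap V_decreasing[of \<rho>] \<rho> by (intro mult_left_mono) auto
        also have "\<dots> \<le> V (radius t) - V (W t)"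
          using V_drop[of "radius t" "W t" \<rho>] rad gap \<rho> W\<rho> by auto
        finally show ?thesis using True by (simp add: \<kappa>_def)
      qed
    qed
    then show ?thesis by (simp add: k_def gt)
  qed
  have "\<kappa> * (b - a) - (2 * \<delta>\<^sup>2 / \<tau>) / 2 \<le> integral {-T..T} (\<lambda>t. (speed t)\<^sup>2 - h) - integral {-T..T} f"
    by (rule has_integral_le[OF k g]) (use k_le in auto)
  with \<open>\<delta>\<^sup>2 / \<tau> < \<kappa> * (b - a)\<close> have "integral {-T..T} f < integral {-T..T} (\<lambda>t. (speed t)\<^sup>2 - h)"
    by simp
  then show ?thesis
    using that[OF \<tau> f, of \<delta>] by (simp add: f_def W_def)
qed

text \<open>Since \<open>\<tau> < T\<close>, the tent vanishes at both ends and the end points are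
  kept; the heights \<open>0\<close> and \<open>\<delta>\<close> give the two actions to
  compare.\<close>

lemma transmission_not_minimal:
  fixes e :: "real^2"
  assumes "norm e = 1" and w: "\<And>t. t \<in> {-T..T} \<Longrightarrow> w t = position t *\<^sub>R e"
  shows "w \<in> joining_paths T (w (-T)) (w T)
    \<and> (\<exists>w' \<in> joining_paths T (w (-T)) (w T). action V T w' < action V T w)"
proof -
  \<comment> \<open>The quarter turn of \<open>e\<close>.\<close>
  define n :: "real^2" where "n = (\<chi> i. if i = 1 then - e $ 2 else e $ 1)"
  have n: "e \<bullet> n = 0" "norm n = 1"
    using assms(1) by (auto simp: n_def norm_eq_1 inner_vec_def sum_2 algebra_simps)
  obtain \<tau> \<delta> f where \<tau>: "0 < \<tau>" "\<tau> < T"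
    and f: "f absolutely_integrable_on {-T..T}"
      "\<And>t. t \<in> {-T..T} - {0} \<Longrightarrow>
      f t = ((speed t)\<^sup>2 + (bump_deriv \<tau> \<delta> t)\<^sup>2) / 2 + V (sqrt ((radius t)\<^sup>2 + (bump \<tau> \<delta> t)\<^sup>2))"
    and less: "integral {-T..T} f < integral {-T..T} (\<lambda>t. (speed t)\<^sup>2 - h)"
    using bump_lowers_action by metis
  have w0: "w t = position t *\<^sub>R e + bump \<tau> 0 t *\<^sub>R n" if "t \<in> {-T..T}" for t
    using w that by (simp add: bump_def)
  define w' where "w' t = position t *\<^sub>R e + bump \<tau> \<delta> t *\<^sub>R n" for t
  have "action V T w' = ereal (integral {-T..T} f)"
    by (rule perturbed_path_action[OF assms(1) n(2,1) \<tau> w'_def f])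
  moreover have "action V T w = ereal (integral {-T..T} (\<lambda>t. (speed t)\<^sup>2 - h))"
  proof (rule perturbed_path_action[OF assms(1) n(2,1) \<tau> w0])
    have "(\<lambda>t. (speed t)\<^sup>2) absolutely_integrable_on {-T..T}"
      using speed_squared_integrable by (rule nonnegative_absolutely_integrable_1) simp
    then show "(\<lambda>t. (speed t)\<^sup>2 - h) absolutely_integrable_on {-T..T}"
      by (intro set_integral_diff) auto
    fix t assume t: "t \<in> {-T..T} - {0}"
    then have "sqrt ((radius t)\<^sup>2 + (bump \<tau> 0 t)\<^sup>2) = radius t" "bump_deriv \<tau> 0 t = 0"
      using radius_pos[of t] by (auto simp: bump_def bump_deriv_def)
    then show "(speed t)\<^sup>2 - h = ((speed t)\<^sup>2 + (bump_deriv \<tau> 0 t)\<^sup>2) / 2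
        + V (sqrt ((radius t)\<^sup>2 + (bump \<tau> 0 t)\<^sup>2))"
      using speed_squared[of t] t by simp
  qed
  ultimately have "action V T w' < action V T w" using less by simp
  moreover have "H1_path T w" "H1_path T w'"
    using perturbed_path_H1[OF assms(1) n(2,1) \<tau>] w0 w'_def by blast+
  moreover have "w' (-T) = w (-T)" "w' T = w T"
    using w[of T] w[of "-T"] \<tau> by (auto simp: w'_def bump_def field_simps)
  ultimately show ?thesis
    by (auto simp: joining_paths_def)
qed

end

text \<open>\<open>is_arg_min\<close> includes membership in \<open>\<Lambda>\<close>; with
  \<open>u\<^sub>0 \<in> \<Lambda>\<close> stated alongside, its failure means that some competitor
  has strictly smaller action.\<close>

theorem theorem5:
  fixes V :: "real \<Rightarrow> real" and T :: real and u u\<^sub>0 :: "real \<Rightarrow> real^2"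
    and \<Lambda> :: "(real \<Rightarrow> real^2) set"
  assumes "V \<in> class_V_star"
    and "T > 0"
    and "collision_solution V T u"
    and "u\<^sub>0 = transmission u"
    and "\<Lambda> = joining_paths T (u\<^sub>0 (-T)) (u\<^sub>0 T)"
  shows "u\<^sub>0 \<in> \<Lambda> \<and> \<not> is_arg_min (action V T) (\<lambda>w. w \<in> \<Lambda>) u\<^sub>0"
proof -
  obtain R where "collapsing_potential V R"
    using class_V_star_collapsing[OF assms(1)] .
  then interpret collapsing_potential V R .
  obtain e r p h where e: "norm e = 1"
    and u: "\<And>t. t \<in> {-T..<0} \<Longrightarrow> u t = r t *\<^sub>R e"
    and rp: "\<And>t. t \<in> {-T..<0} \<Longrightarrow> r t > 0"
      "\<And>t. t \<in> {-T..<0} \<Longrightarrow> (r has_real_derivative p t) (at t within {-T..<0})"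
      "continuous_on {-T..<0} p"
      "\<And>t. t \<in> {-T..<0} \<Longrightarrow> (p t)\<^sup>2 = 2 * (h + V (r t))"
      "(r \<longlongrightarrow> 0) (at_left 0)"
    using collision_radial[OF assms(2,3)] by blast
  interpret radial_collision V R T h r p
    by unfold_locales (use assms(2) rp in auto)
  have "u\<^sub>0 t = position t *\<^sub>R e" if "t \<in> {-T..T}" for t
    using u[of t] u[of "-t"] that
    by (auto simp: assms(4) transmission_def position_def radius_def)
  from transmission_not_minimal[OF e this] show ?thesis
    by (auto simp: assms(5) is_arg_min_def)
qed

end
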